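(* Let $d\ge 3$ and $n\ge 2$. A configuration $\sigma$ of $n$ points is a ground state if and only if, for any dyadic cube $D\in\mathcal{D}$ with children $D_1,D_2,\dots,D_{2^d}$, the following two conditions are satisfied: (1) $N(D)=\sum_{i=1}^{2^d}N(D_i)$; (2) $|N(D_i)-N(D_j)|\le 1$ for all $i,j$. Here $N(\cdot)$ denotes the number of points of $\sigma$ in the given cube.
   Context: Dyadic cubes: for $k\ge 0$, $\mathcal{D}_k$ is the set of all cubes $\prod_{l=1}^d\left[\frac{i_l}{2^k},\frac{i_l+1}{2^k}\right)$ with $0\le i_1,\dots,i_d\le 2^k-1$, and $\mathcal{D}=\bigcup_{k\ge0}\mathcal{D}_k$. The children of $D\in\mathcal{D}_k$ are the $2^d$ cubes of $\mathcal{D}_{k+1}$ contained in $D$. For distinct points $x,y\in[0,1)^d$ set $w(x,y)=2^{(d-2)(k-1)}$, where $k$ is the smallest integer such that $x$ and $y$ do not belong to the same cube of $\mathcal{D}_k$. A configuration is an $n$-tuple $\mathbf{x}=(x_1,\dots,x_n)$ of distinct points of $[0,1)^d$, none lying on the boundary of a dyadic cube; its energy is $H_n(\mathbf{x})=\sum_{i\ne j}w(x_i,x_j)$ (sum over ordered pairs). A ground state is a configuration of $n$ points whose energy equals $L_n:=\min_{\mathbf{x}}H_n(\mathbf{x})$, the minimum over all configurations of $n$ points. (Condition (1) is automatic for a configuration.) *)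

theory Defs
  imports "HOL-Analysis.Analysis"
begin

definition unit_cube :: "(real ^ 'd) set" where
  "unit_cube = {x. \<forall>l. x $ l \<in> {0..<1}}"

definition dyadic_cubes :: "nat \<Rightarrow> (real ^ 'd) set set" where
  "dyadic_cubes k =
     {{x. \<forall>l. x $ l \<in> {real (i l) / 2 ^ k ..< (real (i l) + 1) / 2 ^ k}}
        | i :: 'd \<Rightarrow> nat. \<forall>l. i l \<le> 2 ^ k - 1}"

definition children :: "nat \<Rightarrow> (real ^ 'd) set \<Rightarrow> (real ^ 'd) set set" where
  "children k D = {D' \<in> dyadic_cubes (Suc k). D' \<subseteq> D}"

definition separation_level :: "real ^ 'd \<Rightarrow> real ^ 'd \<Rightarrow> nat" where
  "separation_level x y = (LEAST k. \<not> (\<exists>D \<in> dyadic_cubes k. x \<in> D \<and> y \<in> D))"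

definition interaction :: "real ^ 'd \<Rightarrow> real ^ 'd \<Rightarrow> real" where
  "interaction x y = 2 powi ((int CARD('d) - 2) * (int (separation_level x y) - 1))"

text \<open>An \<open>n\<close>-tuple is a function on \<open>nat\<close>, of which only the values on \<open>{..<n}\<close> matter.\<close>

definition configuration :: "nat \<Rightarrow> (nat \<Rightarrow> real ^ 'd) \<Rightarrow> bool" where
  "configuration n x \<longleftrightarrow>
     inj_on x {..<n} \<and>
     (\<forall>i<n. x i \<in> unit_cube \<and> (\<forall>k. \<forall>D \<in> dyadic_cubes k. x i \<notin> frontier D))"

definition energy :: "nat \<Rightarrow> (nat \<Rightarrow> real ^ 'd) \<Rightarrow> real" where
  "energy n x = (\<Sum>(i, j) \<in> {(i, j). i < n \<and> j < n \<and> i \<noteq> j}. interaction (x i) (x j))"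

text \<open>The type argument supplies the dimension. The minimum exists: see
  \<open>minimal_energy_attained\<close> below.\<close>

definition minimal_energy :: "'d::finite itself \<Rightarrow> nat \<Rightarrow> real" where
  "minimal_energy _ n =
     (LEAST e. \<exists>x :: nat \<Rightarrow> real ^ 'd. configuration n x \<and> e = energy n x)"

definition ground_state :: "nat \<Rightarrow> (nat \<Rightarrow> real ^ 'd) \<Rightarrow> bool" where
  "ground_state n x \<longleftrightarrow> configuration n x \<and> energy n x = minimal_energy TYPE('d) n"

definition num_points :: "nat \<Rightarrow> (nat \<Rightarrow> real ^ 'd) \<Rightarrow> (real ^ 'd) set \<Rightarrow> nat" where
  "num_points n x D = card {i. i < n \<and> x i \<in> D}"

lemma unit_cube_dyadic: "unit_cube \<in> dyadic_cubes 0"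
  unfolding unit_cube_def dyadic_cubes_def by (auto intro!: exI[of _ "\<lambda>_. 0"])

lemma separation_level_pos:
  fixes x y :: "real ^ 'd"
  assumes "x \<in> unit_cube" "y \<in> unit_cube" "x \<noteq> y"
  shows "separation_level x y \<ge> 1"
proof -
  obtain l where l: "x $ l \<noteq> y $ l" using assms(3) by (auto simp: vec_eq_iff)
  obtain k where k: "inverse (2 ^ k) < \<bar>x $ l - y $ l\<bar>"
    using real_arch_pow_inv[of "\<bar>x $ l - y $ l\<bar>" "inverse 2"] l by (auto simp: power_one_over inverse_eq_divide)
  have sep: "\<not> (\<exists>D \<in> dyadic_cubes k. x \<in> D \<and> y \<in> D)"
  proof
    assume "\<exists>D \<in> dyadic_cubes k. x \<in> D \<and> y \<in> D"
    then obtain i :: "'d \<Rightarrow> nat" where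
      "x $ l \<in> {real (i l) / 2 ^ k ..< (real (i l) + 1) / 2 ^ k}"
      "y $ l \<in> {real (i l) / 2 ^ k ..< (real (i l) + 1) / 2 ^ k}"
      unfolding dyadic_cubes_def by blast
    with k show False by (auto simp: add_divide_distrib inverse_eq_divide)
  qed
  then have "\<not> (\<exists>D \<in> dyadic_cubes (separation_level x y). x \<in> D \<and> y \<in> D)"
    unfolding separation_level_def by (rule LeastI)
  then have "separation_level x y \<noteq> 0"
    using unit_cube_dyadic assms(1,2) by metis
  then show ?thesis by simp
qed

lemma energy_Nats:
  fixes x :: "nat \<Rightarrow> real ^ 'd"
  assumes "CARD('d) \<ge> 2" "configuration n x"
  shows "energy n x \<in> \<nat>"
proof -
  have "interaction (x i) (x j) \<in> \<nat>" if "i < n" "j < n" "i \<noteq> j" for i j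
  proof -
    have "separation_level (x i) (x j) \<ge> 1"
      using assms(2) that unfolding configuration_def
      by (intro separation_level_pos) (auto dest: inj_onD)
    then have "(int CARD('d) - 2) * (int (separation_level (x i) (x j)) - 1) \<ge> 0"
      using assms(1) by simp
    then show ?thesis
      unfolding interaction_def power_int_def
      by (metis of_nat_in_Nats of_nat_numeral of_nat_power)
  qed
  moreover have sum_Nats: "sum f A \<in> \<nat>" if "\<And>a. a \<in> A \<Longrightarrow> f a \<in> \<nat>"
    for f :: "nat \<times> nat \<Rightarrow> real" and A
    using that by (induction A rule: infinite_finite_induct) auto
  ultimately show ?thesis unfolding energy_def by (intro sum_Nats) auto
qed

lemma minimal_energy_attained:
  fixes x :: "nat \<Rightarrow> real ^ 'd"
  assumes "CARD('d) \<ge> 2" "configuration n x"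
  obtains y :: "nat \<Rightarrow> real ^ 'd" where
    "configuration n y" "energy n y = minimal_energy TYPE('d) n"
    "\<And>z :: nat \<Rightarrow> real ^ 'd. configuration n z \<Longrightarrow> energy n y \<le> energy n z"
proof -
  obtain y :: "nat \<Rightarrow> real ^ 'd" where y: "configuration n y"
    and least: "\<And>z :: nat \<Rightarrow> real ^ 'd. configuration n z \<Longrightarrow> nat \<lfloor>energy n y\<rfloor> \<le> nat \<lfloor>energy n z\<rfloor>"
    using ex_has_least_nat[of "configuration n" x "\<lambda>z. nat \<lfloor>energy n z\<rfloor>"] assms(2) by blast
  have min: "energy n y \<le> energy n z" if z: "configuration n z" for z :: "nat \<Rightarrow> real ^ 'd"
    using least[OF z] energy_Nats[OF assms(1) y] energy_Nats[OF assms(1) z]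
    by (auto elim!: Nats_cases)
  have "minimal_energy TYPE('d) n = energy n y"
    unfolding minimal_energy_def by (rule Least_equality) (use y min in auto)
  with y min that show thesis by metis
qed

end

theory Submission
  imports Defs
begin

text \<open>
  Write \<open>q = 2 ^ (d - 2)\<close> and \<open>b = 2 ^ d\<close>. A pair of points that is separated at level \<open>s\<close> has
  interaction \<open>q ^ (s - 1)\<close>, and a telescoping sum turns this into \<open>1\<close> plus the increments
  \<open>q ^ k - q ^ (k - 1)\<close> over all levels \<open>k \<ge> 1\<close> at which the two points still share a cube. Summed over
  pairs, the energy becomes a constant plus a combination of the numbers of ordered pairs sharing
  a cube of level \<open>k\<close>, that is, of \<open>\<Sum>\<^sub>D N(D)\<^sup>2 - n\<close> (\<open>energy_eq_sum_levels\<close>). The coefficients are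
  strictly positive precisely because \<open>d \<ge> 3\<close>.

  At a fixed level the \<open>N(D)\<close> are \<open>b ^ k\<close> natural numbers with sum \<open>n\<close>. Put \<open>t = n div b ^ k\<close>. Then
  \<open>\<Sum>\<^sub>D N(D)\<^sup>2\<close> is a constant plus the excess \<open>\<Sum>\<^sub>D (N(D) - t) (N(D) - t - 1)\<close>, whose terms are
  nonnegative on integers and vanish exactly at \<open>t\<close> and \<open>t + 1\<close>. So every level has its own lower
  bound, and the point is that all of them can be attained at once: the radical inverse sequence
  (van der Corput's digit reversal, in base \<open>b\<close>) spreads \<open>0, \<dots>, n - 1\<close> over the cubes of level
  \<open>k\<close> according to their residues modulo \<open>b ^ k\<close> (\<open>exists_zero_excess_configuration\<close>). Hence the
  ground states are the configurations whose excess vanishes at every level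
  (\<open>ground_state_iff_excess_0\<close>).

  Vanishing excess compares all cubes of a level, whereas the theorem compares only siblings.
  The two agree because no discrepancy builds up from level to level: balanced children of a cube
  with \<open>t\<close> or \<open>t + 1\<close> points hold \<open>t div b\<close> or \<open>t div b + 1\<close> points each, and \<open>t div b\<close> is again
  \<open>n div b ^ (k + 1)\<close> (\<open>siblings_balanced_imp_level_balanced\<close>).
\<close>

section \<open>Addresses of dyadic cubes\<close>

text \<open>
  Replacing a dyadic cube by its integer corner at scale \<open>2 ^ k\<close> makes two points share a cube iff
  their addresses are equal, and makes passing to the parent cube a division by two.
\<close>

definition address :: "nat \<Rightarrow> real ^ 'd \<Rightarrow> 'd \<Rightarrow> int" where
  "address k x = (\<lambda>l. \<lfloor>2 ^ k * x $ l\<rfloor>)"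

definition addresses :: "nat \<Rightarrow> ('d \<Rightarrow> int) set" where
  "addresses k = {a. \<forall>l. a l \<in> {0..<2 ^ k}}"

definition cell :: "nat \<Rightarrow> ('d \<Rightarrow> int) \<Rightarrow> (real ^ 'd) set" where
  "cell k a = {x. address k x = a}"

lemma floor_scaled_eq_iff:
  "\<lfloor>2 ^ k * r\<rfloor> = z \<longleftrightarrow> r \<in> {of_int z / 2 ^ k ..< (of_int z + 1) / 2 ^ k}" for r :: real
  by (auto simp: floor_eq_iff field_simps)

lemma dyadic_cubes_eq: "dyadic_cubes k = cell k ` (addresses k :: ('d::finite \<Rightarrow> int) set)"
proof (intro equalityI subsetI)
  fix D :: "(real ^ 'd) set" assume "D \<in> dyadic_cubes k"
  then obtain i :: "'d \<Rightarrow> nat" where i: "\<forall>l. i l \<le> 2 ^ k - 1"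
    and D: "D = {x. \<forall>l. x $ l \<in> {real (i l) / 2 ^ k ..< (real (i l) + 1) / 2 ^ k}}"
    unfolding dyadic_cubes_def by blast
  have "D = cell k (\<lambda>l. int (i l))"
    unfolding D cell_def address_def fun_eq_iff floor_scaled_eq_iff by simp
  moreover have "int (i l) < 2 ^ k" for l
  proof -
    have "(0 :: nat) < 2 ^ k" by simp
    then have "i l < 2 ^ k" using i[rule_format, of l] by linarith
    then show ?thesis by (metis of_nat_less_iff of_nat_numeral of_nat_power)
  qed
  ultimately show "D \<in> cell k ` addresses k"
    unfolding addresses_def by auto
next
  fix D :: "(real ^ 'd) set" assume "D \<in> cell k ` addresses k"
  then obtain a where a: "\<forall>l. 0 \<le> a l \<and> a l < 2 ^ k" and D: "D = cell k a"
    unfolding addresses_def by auto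
  have "nat (a l) \<le> 2 ^ k - 1" for l
    using a[rule_format, of l] by (simp add: nat_le_iff of_nat_diff)
  moreover have "D = {x. \<forall>l. x $ l \<in> {real (nat (a l)) / 2 ^ k ..< (real (nat (a l)) + 1) / 2 ^ k}}"
    using a unfolding D cell_def address_def fun_eq_iff floor_scaled_eq_iff by simp
  ultimately show "D \<in> dyadic_cubes k"
    unfolding dyadic_cubes_def by (auto intro!: exI[of _ "\<lambda>l. nat (a l)"])
qed

lemma address_in_addresses:
  assumes "x \<in> unit_cube"
  shows "address k x \<in> addresses k"
  using assms by (auto simp: unit_cube_def address_def addresses_def floor_less_iff)

lemma address_Suc_div: "address (Suc k) x l div 2 = address k x l"
proof -
  have "\<lfloor>2 ^ Suc k * x $ l\<rfloor> div 2 = \<lfloor>2 ^ Suc k * x $ l / 2\<rfloor>"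
    using floor_divide_real_eq_div[of 2 "2 ^ Suc k * x $ l"] by simp
  then show ?thesis by (simp add: address_def)
qed

lemma address_eq_mono:
  assumes "address k x = address k y" "j \<le> k"
  shows "address j x = address j y"
  using assms(2,1)
proof (induction k rule: dec_induct)
  case (step k)
  from step.prems have "address k x = address k y"
    by (metis address_Suc_div ext)
  then show ?case by (rule step.IH)
qed

lemma card_addresses: "card (addresses k :: ('d::finite \<Rightarrow> int) set) = (2 ^ CARD('d)) ^ k"
proof -
  have "(addresses k :: ('d \<Rightarrow> int) set) = PiE UNIV (\<lambda>_. {0..<2 ^ k})"
    by (auto simp: addresses_def PiE_def)
  then show ?thesis
    by (simp add: card_PiE nat_power_eq mult.commute flip: power_mult)
qed

lemma finite_addresses: "finite (addresses k :: ('d::finite \<Rightarrow> int) set)"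
  by (rule card_ge_0_finite) (simp add: card_addresses)

lemma cell_nonempty: "cell k a \<noteq> ({} :: (real ^ 'd::finite) set)"
proof -
  have "(\<chi> l. of_int (a l) / 2 ^ k) \<in> cell k a"
    by (simp add: cell_def address_def)
  then show ?thesis by blast
qed

lemma inj_cell: "inj (cell k :: ('d::finite \<Rightarrow> int) \<Rightarrow> (real ^ 'd) set)"
proof (rule injI)
  fix a b :: "'d \<Rightarrow> int" assume "cell k a = (cell k b :: (real ^ 'd) set)"
  moreover obtain x :: "real ^ 'd" where "x \<in> cell k a" using cell_nonempty by blast
  ultimately show "a = b" by (auto simp: cell_def)
qed

definition child_addresses :: "('d \<Rightarrow> int) \<Rightarrow> ('d \<Rightarrow> int) set" where
  "child_addresses a = {a'. \<forall>l. a' l div 2 = a l}"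

lemma child_in_addresses_iff:
  assumes "a' \<in> child_addresses a"
  shows "a' \<in> addresses (Suc k) \<longleftrightarrow> a \<in> addresses k"
proof -
  have half: "z div 2 \<in> {0..<m} \<longleftrightarrow> z \<in> {0..<2 * m}" for z m :: int
    by auto
  have "a = (\<lambda>l. a' l div 2)" using assms by (auto simp: child_addresses_def)
  then show ?thesis
    unfolding addresses_def by (simp only: half mem_Collect_eq power_Suc)
qed

lemma card_child_addresses: "card (child_addresses a) = 2 ^ CARD('d)" for a :: "'d::finite \<Rightarrow> int"
proof -
  have "z div 2 = w \<longleftrightarrow> z \<in> {2 * w, 2 * w + 1}" for z w :: int
    by auto
  then have "child_addresses a = PiE UNIV (\<lambda>l. {2 * a l, 2 * a l + 1})"
    by (auto simp: child_addresses_def PiE_def Pi_def)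
  then show ?thesis by (simp add: card_PiE numeral_2_eq_2)
qed

lemma address_in_child_addresses_iff:
  "address (Suc k) x \<in> child_addresses a \<longleftrightarrow> address k x = a"
  by (auto simp: child_addresses_def address_Suc_div)

lemma children_cell:
  fixes a :: "'d::finite \<Rightarrow> int"
  assumes "a \<in> addresses k"
  shows "children k (cell k a) = cell (Suc k) ` child_addresses a"
proof -
  have "cell (Suc k) a' \<subseteq> cell k a \<longleftrightarrow> a' \<in> child_addresses a" for a' :: "'d \<Rightarrow> int"
  proof
    assume sub: "cell (Suc k) a' \<subseteq> cell k a"
    obtain x :: "real ^ 'd" where x: "x \<in> cell (Suc k) a'" using cell_nonempty by blast
    with sub have "address (Suc k) x = a'" "address k x = a" by (auto simp: cell_def)
    then show "a' \<in> child_addresses a"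
      using address_in_child_addresses_iff by blast
  next
    assume "a' \<in> child_addresses a"
    then show "cell (Suc k) a' \<subseteq> cell k a"
      unfolding cell_def using address_in_child_addresses_iff by blast
  qed
  moreover have "child_addresses a \<subseteq> addresses (Suc k)"
    using assms child_in_addresses_iff by blast
  ultimately show ?thesis
    unfolding children_def dyadic_cubes_eq by auto
qed

section \<open>Occupation numbers\<close>

definition occupancy :: "nat \<Rightarrow> (nat \<Rightarrow> real ^ 'd) \<Rightarrow> nat \<Rightarrow> ('d \<Rightarrow> int) \<Rightarrow> nat" where
  "occupancy n x k a = card {i. i < n \<and> address k (x i) = a}"

lemma num_points_cell: "num_points n x (cell k a) = occupancy n x k a"
  by (simp add: num_points_def occupancy_def cell_def)

lemma sum_card_fibres:
  assumes "finite I" "finite A" "f ` I \<subseteq> A"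
  shows "(\<Sum>a\<in>A. card {i \<in> I. f i = a}) = card I"
  using sum.group[OF assms, of "\<lambda>_. 1 :: nat"] by simp

lemma sum_occupancy:
  fixes x :: "nat \<Rightarrow> real ^ 'd::finite"
  assumes "configuration n x"
  shows "(\<Sum>a\<in>addresses k. occupancy n x k a) = n"
  using sum_card_fibres[of "{..<n}" "addresses k" "\<lambda>i. address k (x i)"] assms
  by (auto simp: occupancy_def finite_addresses configuration_def intro: address_in_addresses)

lemma sum_occupancy_children:
  fixes x :: "nat \<Rightarrow> real ^ 'd::finite"
  shows "(\<Sum>a'\<in>child_addresses a. occupancy n x (Suc k) a') = occupancy n x k a"
proof -
  let ?I = "{i. i < n \<and> address k (x i) = a}"
  have eq: "{i. i < n \<and> address (Suc k) (x i) = a'} = {i \<in> ?I. address (Suc k) (x i) = a'}"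
    if "a' \<in> child_addresses a" for a'
    using that address_in_child_addresses_iff by blast
  have "finite (child_addresses a)"
    by (rule card_ge_0_finite) (simp add: card_child_addresses)
  moreover have "(\<lambda>i. address (Suc k) (x i)) ` ?I \<subseteq> child_addresses a"
    by (auto simp: address_in_child_addresses_iff)
  ultimately have "(\<Sum>a'\<in>child_addresses a. card {i \<in> ?I. address (Suc k) (x i) = a'}) = card ?I"
    by (intro sum_card_fibres) auto
  then show ?thesis unfolding occupancy_def by (simp add: eq)
qed

text \<open>
  Double counting: the pairs with \<open>i = j\<close> included, a fibre with \<open>N\<close> elements contributes \<open>N\<^sup>2\<close>, and the
  diagonal accounts for \<open>n\<close> of them.
\<close>

lemma pairs_in_same_fibre:
  fixes f :: "nat \<Rightarrow> 'a"
  assumes "finite A" "f ` {..<n} \<subseteq> A"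
  shows "(\<Sum>(i, j)\<in>{(i, j). i < n \<and> j < n \<and> i \<noteq> j}. of_bool (f i = f j)) =
    (\<Sum>a\<in>A. (real (card {i. i < n \<and> f i = a}))\<^sup>2) - real n"
proof -
  let ?S = "{(i, j). i < n \<and> j < n \<and> i \<noteq> j}"
  have card: "real (card {i. i < n \<and> f i = a}) = (\<Sum>i<n. of_bool (f i = a))" for a
  proof -
    have "{i. i < n \<and> f i = a} = {..<n} \<inter> {i. f i = a}" by auto
    then show ?thesis by simp
  qed
  have one: "(\<Sum>a\<in>A. of_bool (f i = a) * of_bool (f j = a)) = (of_bool (f i = f j) :: real)"
    if "i < n" for i j
  proof -
    have "(\<Sum>a\<in>A. of_bool (f i = a) * of_bool (f j = a)) =
        (\<Sum>a\<in>A. if f i = a then of_bool (f i = f j) else (0 :: real))"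
      by (intro sum.cong) auto
    also have "\<dots> = of_bool (f i = f j)"
      using that assms by (auto simp: sum.delta)
    finally show ?thesis .
  qed
  have "(\<Sum>a\<in>A. (real (card {i. i < n \<and> f i = a}))\<^sup>2) =
      (\<Sum>a\<in>A. \<Sum>i<n. \<Sum>j<n. of_bool (f i = a) * of_bool (f j = a))"
    unfolding card power2_eq_square sum_product ..
  also have "\<dots> = (\<Sum>i<n. \<Sum>a\<in>A. \<Sum>j<n. of_bool (f i = a) * of_bool (f j = a))"
    by (rule sum.swap)
  also have "\<dots> = (\<Sum>i<n. \<Sum>j<n. \<Sum>a\<in>A. of_bool (f i = a) * of_bool (f j = a))"
    by (intro sum.cong refl sum.swap)
  also have "\<dots> = (\<Sum>i<n. \<Sum>j<n. of_bool (f i = f j))"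
    by (intro sum.cong refl) (simp add: one)
  also have "\<dots> = (\<Sum>(i, j)\<in>{..<n} \<times> {..<n}. of_bool (f i = f j))"
    by (rule sum.cartesian_product)
  also have "{..<n} \<times> {..<n} = ?S \<union> (\<lambda>i. (i, i)) ` {..<n}"
    by auto
  also have "(\<Sum>(i, j)\<in>?S \<union> (\<lambda>i. (i, i)) ` {..<n}. of_bool (f i = f j)) =
      (\<Sum>(i, j)\<in>?S. of_bool (f i = f j)) + (\<Sum>(i, j)\<in>(\<lambda>i. (i, i)) ` {..<n}. of_bool (f i = f j) :: real)"
    by (rule sum.union_disjoint) (auto intro: finite_subset[of _ "{..<n} \<times> {..<n}"])
  also have "(\<Sum>(i, j)\<in>(\<lambda>i. (i, i)) ` {..<n}. of_bool (f i = f j)) = real n"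
    by (subst sum.reindex) (auto simp: inj_on_def)
  finally show ?thesis by simp
qed

section \<open>The energy as a sum over levels\<close>

lemma same_cube_iff_address_eq:
  fixes x y :: "real ^ 'd::finite"
  assumes "x \<in> unit_cube"
  shows "(\<exists>D \<in> dyadic_cubes k. x \<in> D \<and> y \<in> D) \<longleftrightarrow> address k x = address k y"
  using address_in_addresses[OF assms, of k] by (auto simp: dyadic_cubes_eq cell_def)

lemma address_separates:
  fixes x y :: "real ^ 'd::finite"
  assumes "x \<noteq> y"
  shows "\<exists>k. address k x \<noteq> address k y"
proof -
  obtain l where l: "x $ l \<noteq> y $ l" using assms by (auto simp: vec_eq_iff)
  then obtain k where k: "1 / \<bar>x $ l - y $ l\<bar> < 2 ^ k"
    using real_arch_pow[of 2] by fastforce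
  then have "1 < 2 ^ k * \<bar>x $ l - y $ l\<bar>"
    using l by (simp add: field_simps)
  also have "\<dots> = \<bar>2 ^ k * x $ l - 2 ^ k * y $ l\<bar>"
    by (simp add: abs_mult flip: right_diff_distrib)
  finally have "address k x l \<noteq> address k y l"
    unfolding address_def by linarith
  then show ?thesis by metis
qed

text \<open>
  Since the cubes are nested, the least level that separates two points determines at which levels
  they share a cube.
\<close>

lemma address_eq_iff_less_separation_level:
  fixes x y :: "real ^ 'd::finite"
  assumes "x \<in> unit_cube" "x \<noteq> y"
  shows "address k x = address k y \<longleftrightarrow> k < separation_level x y"
proof -
  have s: "separation_level x y = (LEAST k. address k x \<noteq> address k y)"
    unfolding separation_level_def same_cube_iff_address_eq[OF assms(1)] ..
  have "address (separation_level x y) x \<noteq> address (separation_level x y) y"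
    unfolding s using address_separates[OF assms(2)] by (rule LeastI_ex)
  then have "k < separation_level x y" if "address k x = address k y"
    using that address_eq_mono by (metis not_le)
  moreover have "address k x = address k y" if "k < separation_level x y"
    using that not_less_Least unfolding s by blast
  ultimately show ?thesis by blast
qed

text \<open>
  The energy gained by a pair for sharing a cube of level \<open>k + 1\<close>; the shift by one drops level
  \<open>0\<close>, where all points share the unit cube.
\<close>

definition level_weight :: "'d::finite itself \<Rightarrow> nat \<Rightarrow> real" where
  "level_weight _ k = (2 ^ (CARD('d) - 2)) ^ Suc k - (2 ^ (CARD('d) - 2)) ^ k"

lemma level_weight_pos:
  assumes "CARD('d::finite) \<ge> 3"
  shows "level_weight TYPE('d) k > 0"
proof -
  have "(2 ^ (CARD('d) - 2) :: real) > 1" using assms by simp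
  then show ?thesis unfolding level_weight_def by simp
qed

text \<open>
  The weights of the levels below the separation level telescope to the interaction. The cutoff
  \<open>K\<close> only has to lie beyond the levels that the two points share; leaving it free allows one cutoff
  for all pairs, and later for two configurations.
\<close>

lemma interaction_eq_sum:
  fixes x y :: "real ^ 'd::finite"
  assumes "CARD('d) \<ge> 2" "x \<in> unit_cube" "y \<in> unit_cube" "x \<noteq> y" "separation_level x y \<le> Suc K"
  shows "interaction x y =
    1 + (\<Sum>k<K. level_weight TYPE('d) k * of_bool (address (Suc k) x = address (Suc k) y))"
proof -
  let ?q = "2 ^ (CARD('d) - 2) :: real"
  obtain s where s: "separation_level x y = Suc s"
    using separation_level_pos[OF assms(2-4)] by (metis Suc_le_D One_nat_def)
  have "(\<Sum>k<K. level_weight TYPE('d) k * of_bool (address (Suc k) x = address (Suc k) y)) =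
      (\<Sum>k<K. level_weight TYPE('d) k * of_bool (k < s))"
    by (simp add: address_eq_iff_less_separation_level[OF assms(2,4)] s)
  also have "\<dots> = (\<Sum>k<s. level_weight TYPE('d) k)"
    using assms(5) s by (intro sum.mono_neutral_cong_right) auto
  also have "\<dots> = ?q ^ s - 1"
    unfolding level_weight_def by (subst sum_lessThan_telescope) simp
  finally have "1 + (\<Sum>k<K. level_weight TYPE('d) k * of_bool (address (Suc k) x = address (Suc k) y)) = ?q ^ s"
    by simp
  also have "\<dots> = 2 powi int ((CARD('d) - 2) * s)"
    by (simp only: power_int_of_nat power_mult)
  also have "\<dots> = interaction x y"
    using assms(1) by (simp add: interaction_def s of_nat_diff)
  finally show ?thesis by simp
qed

lemma energy_eq_sum_levels:
  fixes x :: "nat \<Rightarrow> real ^ 'd::finite"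
  assumes "CARD('d) \<ge> 2" "configuration n x"
  shows "\<forall>\<^sub>F K in sequentially. energy n x =
    real (card {(i, j). i < n \<and> j < n \<and> i \<noteq> j}) +
    (\<Sum>k<K. level_weight TYPE('d) k *
       ((\<Sum>a\<in>addresses (Suc k). (real (occupancy n x (Suc k) a))\<^sup>2) - real n))"
proof -
  let ?S = "{(i, j). i < n \<and> j < n \<and> i \<noteq> j}"
  have fin: "finite ?S" by (rule finite_subset[of _ "{..<n} \<times> {..<n}"]) auto
  have "\<forall>\<^sub>F K in sequentially. \<forall>p\<in>?S. separation_level (x (fst p)) (x (snd p)) \<le> Suc K"
    using fin by (intro eventually_ball_finite ballI)
      (auto intro: eventually_mono[OF eventually_ge_at_top])
  then show ?thesis
  proof eventually_elim
    case (elim K)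
    let ?same = "\<lambda>k i j. of_bool (address (Suc k) (x i) = address (Suc k) (x j)) :: real"
    have "interaction (x i) (x j) = 1 + (\<Sum>k<K. level_weight TYPE('d) k * ?same k i j)"
      if "i < n" "j < n" "i \<noteq> j" for i j
      using that elim assms
      by (intro interaction_eq_sum) (auto simp: configuration_def inj_on_def)
    then have "energy n x = (\<Sum>(i, j)\<in>?S. 1 + (\<Sum>k<K. level_weight TYPE('d) k * ?same k i j))"
      unfolding energy_def by (intro sum.cong refl) auto
    also have "\<dots> = real (card ?S) + (\<Sum>p\<in>?S. \<Sum>k<K. level_weight TYPE('d) k * (case p of (i, j) \<Rightarrow> ?same k i j))"
      by (simp add: sum.distrib case_prod_unfold)
    also have "(\<Sum>p\<in>?S. \<Sum>k<K. level_weight TYPE('d) k * (case p of (i, j) \<Rightarrow> ?same k i j)) =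
        (\<Sum>k<K. level_weight TYPE('d) k * (\<Sum>(i, j)\<in>?S. ?same k i j))"
      by (subst sum.swap) (simp add: sum_distrib_left)
    also have "\<dots> = (\<Sum>k<K. level_weight TYPE('d) k *
        ((\<Sum>a\<in>addresses (Suc k). (real (occupancy n x (Suc k) a))\<^sup>2) - real n))"
      using assms(2) unfolding occupancy_def
      by (intro sum.cong refl arg_cong2[where f = "(*)"] pairs_in_same_fibre finite_addresses)
        (auto simp: configuration_def intro: address_in_addresses)
    finally show ?case .
  qed
qed

section \<open>The excess over the balanced occupation\<close>

text \<open>
  The amount by which the sum of squared occupation numbers at level \<open>k\<close> exceeds its minimum
  for \<open>n\<close> points, see \<open>sum_squares_occupancy\<close>.
\<close>

definition excess :: "nat \<Rightarrow> (nat \<Rightarrow> real ^ 'd) \<Rightarrow> nat \<Rightarrow> real" where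
  "excess n x k = (let t = real (n div (2 ^ CARD('d)) ^ k) in
     \<Sum>a\<in>addresses k. (real (occupancy n x k a) - t) * (real (occupancy n x k a) - t - 1))"

lemma consecutive_product_nonneg: "(real m - real t) * (real m - real t - 1) \<ge> 0"
proof (cases "m \<le> t")
  case True then show ?thesis by (intro mult_nonpos_nonpos) auto
next
  case False
  then have "real m \<ge> real t + 1" by linarith
  then show ?thesis by (intro mult_nonneg_nonneg) auto
qed

lemma excess_nonneg: "excess n x k \<ge> 0"
  unfolding excess_def Let_def by (intro sum_nonneg consecutive_product_nonneg)

lemma excess_eq_0_iff:
  fixes x :: "nat \<Rightarrow> real ^ 'd::finite"
  shows "excess n x k = 0 \<longleftrightarrow>
    (\<forall>a\<in>addresses k. occupancy n x k a \<in> {n div (2 ^ CARD('d)) ^ k, Suc (n div (2 ^ CARD('d)) ^ k)})"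
proof -
  have *: "(real m - real t) * (real m - real t - 1) = 0 \<longleftrightarrow> m \<in> {t, Suc t}" for m t :: nat
    by auto
  show ?thesis unfolding excess_def Let_def
    by (subst sum_nonneg_eq_0_iff)
       (auto simp del: mult_eq_0_iff simp: * finite_addresses consecutive_product_nonneg)
qed

lemma sum_squares_occupancy:
  fixes x :: "nat \<Rightarrow> real ^ 'd::finite" and k :: nat
  assumes "configuration n x"
  defines "t \<equiv> real (n div (2 ^ CARD('d)) ^ k)"
  shows "(\<Sum>a\<in>addresses k. (real (occupancy n x k a))\<^sup>2) =
    excess n x k + ((2 * t + 1) * n - t * (t + 1) * (2 ^ CARD('d)) ^ k)"
proof -
  have sq: "(real (occupancy n x k a))\<^sup>2 =
      (real (occupancy n x k a) - t) * (real (occupancy n x k a) - t - 1) +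
      ((2 * t + 1) * real (occupancy n x k a) - t * (t + 1))" for a
    by (simp add: algebra_simps power2_eq_square)
  have "(\<Sum>a\<in>addresses k. (2 * t + 1) * real (occupancy n x k a)) = (2 * t + 1) * n"
    by (simp add: sum_occupancy[OF assms(1)] flip: sum_distrib_left of_nat_sum)
  then show ?thesis
    unfolding sq excess_def Let_def t_def[symmetric]
    by (simp add: sum.distrib sum_subtractf card_addresses algebra_simps)
qed

text \<open>
  Apart from the excess, \<open>sum_squares_occupancy\<close> depends only on \<open>n\<close>, \<open>d\<close> and the level, so it cancels
  between two configurations of equally many points.
\<close>

lemma energy_difference:
  fixes x y :: "nat \<Rightarrow> real ^ 'd::finite"
  assumes "CARD('d) \<ge> 2" "configuration n x" "configuration n y" "\<And>k. excess n y k = 0"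
  shows "\<forall>\<^sub>F K in sequentially. energy n x - energy n y =
    (\<Sum>k<K. level_weight TYPE('d) k * excess n x (Suc k))"
  using energy_eq_sum_levels[OF assms(1,2)] energy_eq_sum_levels[OF assms(1,3)]
proof eventually_elim
  case (elim K)
  show ?case
    unfolding elim sum_squares_occupancy[OF assms(2)] sum_squares_occupancy[OF assms(3)] assms(4)
    by (simp add: sum.distrib sum_subtractf algebra_simps)
qed

section \<open>A configuration that is balanced at every level\<close>

text \<open>
  The last \<open>K\<close> base-\<open>2 ^ d\<close> digits of \<open>i\<close> are reversed behind the point: the least significant
  digit picks, through \<open>e\<close>, the set of coordinates in which the cube of level \<open>1\<close> is the upper half,
  and the higher digits act in the same way inside it. The start value \<open>\<theta>\<close> fixes the position inside
  the final cube; an irrational \<open>\<theta>\<close> keeps all points off the boundaries of dyadic cubes.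
\<close>

primrec radical_inverse :: "real \<Rightarrow> (nat \<Rightarrow> 'd set) \<Rightarrow> nat \<Rightarrow> nat \<Rightarrow> real ^ 'd::finite" where
  "radical_inverse \<theta> e 0 i = (\<chi> l. \<theta>)"
| "radical_inverse \<theta> e (Suc K) i =
     (\<chi> l. (radical_inverse \<theta> e K (i div 2 ^ CARD('d)) $ l + of_bool (l \<in> e (i mod 2 ^ CARD('d)))) / 2)"

lemma radical_inverse_bounds:
  assumes "\<theta> \<in> {0<..<1}"
  shows "0 < radical_inverse \<theta> e K i $ l \<and> radical_inverse \<theta> e K i $ l < 1"
proof (induction K arbitrary: i)
  case 0
  show ?case using assms by simp
next
  case (Suc K)
  show ?case using Suc[of "i div 2 ^ CARD('a)"] by (auto simp: of_bool_def)
qed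

lemma radical_inverse_irrational:
  assumes "\<theta> \<notin> \<rat>"
  shows "radical_inverse \<theta> e K i $ l \<notin> \<rat>"
proof (induction K arbitrary: i)
  case 0
  show ?case using assms by simp
next
  case (Suc K)
  let ?r = "radical_inverse \<theta> e K (i div 2 ^ CARD('a)) $ l"
  let ?b = "of_bool (l \<in> e (i mod 2 ^ CARD('a))) :: real"
  show ?case
  proof
    assume "radical_inverse \<theta> e (Suc K) i $ l \<in> \<rat>"
    then have "(?r + ?b) / 2 * 2 - ?b \<in> \<rat>"
      by (intro Rats_diff Rats_mult) (auto simp: of_bool_def)
    moreover have "(u + v) / 2 * 2 - v = u" for u v :: real by (simp add: field_simps)
    ultimately show False using Suc by metis
  qed
qed

text \<open>
  Halving the point moves the address one level down, and the new leading binary digits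
  of the coordinates are those encoded by the least significant digit of \<open>i\<close>.
\<close>

lemma address_radical_inverse_Suc:
  fixes e :: "nat \<Rightarrow> 'd::finite set"
  shows "address (Suc k) (radical_inverse \<theta> e (Suc K) i) l =
    address k (radical_inverse \<theta> e K (i div 2 ^ CARD('d))) l + 2 ^ k * of_bool (l \<in> e (i mod 2 ^ CARD('d)))"
proof -
  have "2 ^ Suc k * ((u + of_bool P) / 2) = 2 ^ k * u + of_int (2 ^ k * of_bool P)" for u :: real and P
    by (cases P) (simp_all add: field_simps)
  then show ?thesis
    unfolding address_def by (simp only: radical_inverse.simps vec_lambda_beta floor_add_int)
qed

lemma radical_inverse_in_unit_cube:
  assumes "\<theta> \<in> {0<..<1}"
  shows "radical_inverse \<theta> e K i \<in> unit_cube"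
  using radical_inverse_bounds[OF assms, of e K i] by (auto simp: unit_cube_def intro: less_imp_le)

text \<open>
  Digit reversal turns the cubes of level \<open>k\<close> into residue classes modulo \<open>(2 ^ d) ^ k\<close>.
\<close>

lemma address_radical_inverse_eq_iff:
  fixes e :: "nat \<Rightarrow> 'd::finite set"
  assumes \<theta>: "\<theta> \<in> {0<..<1}" and e: "inj_on e {..<2 ^ CARD('d)}" and "k \<le> K"
  shows "address k (radical_inverse \<theta> e K i) = address k (radical_inverse \<theta> e K j) \<longleftrightarrow>
    i mod (2 ^ CARD('d)) ^ k = j mod (2 ^ CARD('d)) ^ k"
  using assms(3)
proof (induction k arbitrary: K i j)
  case 0
  have "address 0 (radical_inverse \<theta> e K m) l = 0" for m l
    using radical_inverse_bounds[OF \<theta>, of e K m l] by (simp add: address_def floor_eq_iff)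
  then show ?case by auto
next
  case (Suc k)
  let ?b = "2 ^ CARD('d) :: nat"
  obtain K' where K: "K = Suc K'" and "k \<le> K'" using Suc.prems by (cases K) auto
  let ?A = "\<lambda>m. address k (radical_inverse \<theta> e K' (m div ?b))"
  have range: "0 \<le> ?A m l" "?A m l < 2 ^ k" for m l
    using address_in_addresses[OF radical_inverse_in_unit_cube[OF \<theta>, of e K' "m div ?b"], of k]
    by (auto simp: addresses_def)
  \<comment> \<open>The old address stays below \<open>2 ^ k\<close>, so it does not interfere with the new leading bit.\<close>
  have split: "u + 2 ^ k * of_bool P = v + 2 ^ k * of_bool Q \<longleftrightarrow> u = v \<and> P = Q"
    if "0 \<le> u" "u < 2 ^ k" "0 \<le> v" "v < 2 ^ k" for u v :: int and P Q
    using that by (cases P; cases Q) auto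
  have "address (Suc k) (radical_inverse \<theta> e K i) = address (Suc k) (radical_inverse \<theta> e K j) \<longleftrightarrow>
      (\<forall>l. ?A i l = ?A j l \<and> (l \<in> e (i mod ?b) \<longleftrightarrow> l \<in> e (j mod ?b)))"
    unfolding K fun_eq_iff address_radical_inverse_Suc by (simp add: split range)
  also have "\<dots> \<longleftrightarrow> ?A i = ?A j \<and> e (i mod ?b) = e (j mod ?b)"
    by (auto simp: fun_eq_iff)
  also have "e (i mod ?b) = e (j mod ?b) \<longleftrightarrow> i mod ?b = j mod ?b"
    using e by (auto simp: inj_on_def)
  also have "?A i = ?A j \<longleftrightarrow> i div ?b mod ?b ^ k = j div ?b mod ?b ^ k"
    using Suc.IH[OF \<open>k \<le> K'\<close>] .
  also have "i div ?b mod ?b ^ k = j div ?b mod ?b ^ k \<and> i mod ?b = j mod ?b \<longleftrightarrow>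
      i mod ?b ^ Suc k = j mod ?b ^ Suc k"
  proof
    assume "i div ?b mod ?b ^ k = j div ?b mod ?b ^ k \<and> i mod ?b = j mod ?b"
    then show "i mod ?b ^ Suc k = j mod ?b ^ Suc k"
      by (simp add: mod_mult2_eq)
  next
    assume eq: "i mod ?b ^ Suc k = j mod ?b ^ Suc k"
    show "i div ?b mod ?b ^ k = j div ?b mod ?b ^ k \<and> i mod ?b = j mod ?b"
      using arg_cong[OF eq, of "\<lambda>m. m div ?b"] arg_cong[OF eq, of "\<lambda>m. m mod ?b"]
      by (simp add: mod_mult2_eq)
  qed
  finally show ?case .
qed

lemma cell_frontier_rational:
  fixes x :: "real ^ 'd::finite"
  assumes "x \<in> frontier (cell k a)"
  shows "\<exists>l. x $ l \<in> \<rat>"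
proof (rule ccontr)
  assume irrational: "\<nexists>l. x $ l \<in> \<rat>"
  define u v where "u = (\<chi> l. real_of_int (a l) / 2 ^ k)" and "v = (\<chi> l. (real_of_int (a l) + 1) / 2 ^ k)"
  have mem: "y \<in> cell k a \<longleftrightarrow> (\<forall>l. u $ l \<le> y $ l \<and> y $ l < v $ l)" for y
    unfolding cell_def address_def fun_eq_iff floor_scaled_eq_iff mem_Collect_eq by (simp add: u_def v_def)
  have "cell k a \<subseteq> cbox u v"
    by (auto simp: mem mem_box_cart less_imp_le)
  then have "x \<in> cbox u v"
    using assms closure_minimal[OF _ closed_cbox] unfolding frontier_def by blast
  moreover have "x $ l \<noteq> u $ l" "x $ l \<noteq> v $ l" for l
  proof -
    have "u $ l \<in> \<rat>" "v $ l \<in> \<rat>"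
      unfolding u_def v_def vec_lambda_beta by (intro Rats_divide Rats_add Rats_power Rats_of_int Rats_1 Rats_number_of)+
    then show "x $ l \<noteq> u $ l" "x $ l \<noteq> v $ l" using irrational by metis+
  qed
  ultimately have "x \<in> box u v"
    unfolding mem_box_cart less_le by metis
  moreover have "box u v \<subseteq> interior (cell k a)"
    by (rule interior_maximal[OF _ open_box]) (auto simp: mem mem_box_cart less_imp_le)
  ultimately show False using assms by (auto simp: frontier_def)
qed

lemma card_residue_class:
  fixes m n r :: nat
  assumes "r < m"
  shows "card {i. i < n \<and> i mod m = r} \<in> {n div m, Suc (n div m)}"
proof -
  have "{i. i < n \<and> i mod m = r} = (\<lambda>s. s * m + r) ` {s. s * m + r < n}"
  proof (intro equalityI subsetI)
    fix i assume "i \<in> {i. i < n \<and> i mod m = r}"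
    then have "i = i div m * m + r" "i < n" by auto
    then show "i \<in> (\<lambda>s. s * m + r) ` {s. s * m + r < n}" by auto
  qed (use assms in auto)
  moreover have "inj_on (\<lambda>s. s * m + r) A" for A
    using assms by (auto simp: inj_on_def)
  ultimately have card: "card {i. i < n \<and> i mod m = r} = card {s. s * m + r < n}"
    by (simp add: card_image)
  have n: "n = n div m * m + n mod m" and "n mod m < m" using assms by auto
  have less: "s * m + r < n \<longleftrightarrow> s < n div m \<or> s = n div m \<and> r < n mod m" for s
  proof (cases s "n div m" rule: linorder_cases)
    case less
    then have "Suc s * m \<le> n div m * m" by (intro mult_right_mono) auto
    then have "s * m + r < n" using n assms by (simp only: mult_Suc)
    then show ?thesis using less by simp
  next
    case greater
    then have "Suc (n div m) * m \<le> s * m" by (intro mult_right_mono) auto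
    then have "n < s * m + r" using n \<open>n mod m < m\<close> by (simp only: mult_Suc)
    then show ?thesis using greater by simp
  next
    case equal
    then show ?thesis using n by (metis add_less_cancel_left less_irrefl)
  qed
  have "{s. s * m + r < n} = (if r < n mod m then {..n div m} else {..<n div m})"
    unfolding less by auto
  then show ?thesis unfolding card by auto
qed

text \<open>
  With \<open>n\<close> digits all points have distinct cubes from level \<open>n\<close> on, as \<open>n < (2 ^ d) ^ n\<close>. Up to that
  level the occupation numbers are sizes of residue classes in \<open>{..<n}\<close>; beyond it they are at most
  \<open>1\<close>, while the quotient \<open>n div (2 ^ d) ^ k\<close> is \<open>0\<close>.
\<close>

lemma exists_zero_excess_configuration:
  "\<exists>y :: nat \<Rightarrow> real ^ 'd::finite. configuration n y \<and> (\<forall>k. excess n y k = 0)"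
proof -
  let ?b = "2 ^ CARD('d) :: nat"
  have "card (UNIV :: 'd set set) = ?b"
    by (metis card_Pow finite_UNIV Pow_UNIV finite)
  then obtain e :: "nat \<Rightarrow> 'd set" where "bij_betw e {0..<?b} UNIV"
    using ex_bij_betw_nat_finite[of "UNIV :: 'd set set"] by auto
  then have e: "inj_on e {..<?b}" by (simp add: bij_betw_def atLeast0LessThan)
  have "uncountable ({0<..<1} - \<rat> :: real set)"
    by (intro uncountable_minus_countable countable_rat) (simp add: uncountable_open_interval)
  then obtain \<theta> :: real where \<theta>: "\<theta> \<in> {0<..<1}" "\<theta> \<notin> \<rat>"
    by (metis DiffE countable_empty equals0I)
  have "2 \<le> ?b" using power_increasing[of 1 "CARD('d)" "2 :: nat"] by (simp add: Suc_le_eq)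
  then have "?b ^ n > n" by (intro less_le_trans[OF less_exp power_mono]) simp_all
  let ?y = "radical_inverse \<theta> e n"
  have y_inj: "inj_on (\<lambda>i. address k (?y i)) {..<n}" if "k \<ge> n" for k
  proof (rule inj_onI)
    fix i j assume ij: "i \<in> {..<n}" "j \<in> {..<n}" "address k (?y i) = address k (?y j)"
    then have "address n (?y i) = address n (?y j)" using address_eq_mono that by blast
    then have "i mod ?b ^ n = j mod ?b ^ n" using address_radical_inverse_eq_iff[OF \<theta>(1) e] by blast
    then show "i = j" using ij \<open>?b ^ n > n\<close> by simp
  qed
  have "inj_on ?y {..<n}"
    using y_inj[of n] by (auto simp: inj_on_def)
  moreover have "?y i \<notin> frontier D" if "D \<in> dyadic_cubes k" for i k D
    using that cell_frontier_rational radical_inverse_irrational[OF \<theta>(2)] unfolding dyadic_cubes_eq by blast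
  ultimately have conf: "configuration n ?y"
    by (simp add: configuration_def radical_inverse_in_unit_cube[OF \<theta>(1)])
  have "occupancy n ?y k a \<in> {n div ?b ^ k, Suc (n div ?b ^ k)}" if a: "a \<in> addresses k" for k a
  proof (cases "k \<le> n")
    case True
    let ?f = "\<lambda>r. address k (?y r)"
    have f_eq: "?f i = ?f j \<longleftrightarrow> i mod ?b ^ k = j mod ?b ^ k" for i j
      by (rule address_radical_inverse_eq_iff[OF \<theta>(1) e True])
    \<comment> \<open>There are as many addresses as residues, so every cube belongs to some residue class.\<close>
    have "inj_on ?f {..<?b ^ k}" by (auto simp: inj_on_def f_eq)
    then have "?f ` {..<?b ^ k} = addresses k"
      by (intro card_subset_eq finite_addresses)
         (auto simp: card_image card_addresses intro: address_in_addresses radical_inverse_in_unit_cube[OF \<theta>(1)])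
    then obtain r where r: "r < ?b ^ k" "a = ?f r" using a by blast
    then have "occupancy n ?y k a = card {i. i < n \<and> i mod ?b ^ k = r}"
      by (simp add: occupancy_def f_eq)
    then show ?thesis using card_residue_class[OF r(1)] by simp
  next
    case False
    have "occupancy n ?y k a \<le> Suc 0"
      unfolding occupancy_def using y_inj[of k] False by (subst card_le_Suc0_iff_eq) (auto simp: inj_on_def)
    moreover have "n div ?b ^ k = 0"
      using \<open>?b ^ n > n\<close> False by (intro div_less less_le_trans[OF _ power_increasing[of n k ?b]]) auto
    ultimately show ?thesis by (auto simp: le_Suc_eq)
  qed
  then have "\<forall>k. excess n ?y k = 0"
    by (simp add: excess_eq_0_iff)
  with conf show ?thesis by blast
qed

section \<open>Ground states\<close>

text \<open>
  The energy above that of a configuration without excess is a positive combination of the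
  excesses. The cutoff of that sum may be moved beyond any given level, so each excess occurs in it.
\<close>

lemma ground_state_iff_excess_0:
  fixes x :: "nat \<Rightarrow> real ^ 'd::finite"
  assumes d: "CARD('d) \<ge> 3" and x: "configuration n x"
  shows "ground_state n x \<longleftrightarrow> (\<forall>k. excess n x (Suc k) = 0)"
proof -
  have d2: "CARD('d) \<ge> 2" using d by simp
  obtain y :: "nat \<Rightarrow> real ^ 'd" where y: "configuration n y" "\<And>k. excess n y k = 0"
    using exists_zero_excess_configuration by blast
  have term_nonneg: "level_weight TYPE('d) k * excess n z (Suc k) \<ge> 0" for k and z :: "nat \<Rightarrow> real ^ 'd"
    using level_weight_pos[OF d, of k] excess_nonneg[of n z] by simp
  have diff: "\<exists>K0. \<forall>K\<ge>K0. energy n z - energy n y = (\<Sum>k<K. level_weight TYPE('d) k * excess n z (Suc k))"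
    if z: "configuration n z" for z :: "nat \<Rightarrow> real ^ 'd"
    using energy_difference[OF d2 z y] by (simp add: eventually_sequentially)
  have y_min: "energy n y \<le> energy n z" if z: "configuration n z" for z :: "nat \<Rightarrow> real ^ 'd"
  proof -
    obtain K where "energy n z - energy n y = (\<Sum>k<K. level_weight TYPE('d) k * excess n z (Suc k))"
      using diff[OF z] by blast
    also have "\<dots> \<ge> 0" by (intro sum_nonneg term_nonneg)
    finally show ?thesis by simp
  qed
  have "minimal_energy TYPE('d) n = energy n y"
    unfolding minimal_energy_def by (rule Least_equality) (use y y_min in auto)
  then have "ground_state n x \<longleftrightarrow> energy n x - energy n y = 0"
    using x by (simp add: ground_state_def)
  also have "\<dots> \<longleftrightarrow> (\<forall>k. excess n x (Suc k) = 0)"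
  proof
    assume zero: "energy n x - energy n y = 0"
    obtain K0 where K0: "\<And>K. K \<ge> K0 \<Longrightarrow>
        energy n x - energy n y = (\<Sum>k<K. level_weight TYPE('d) k * excess n x (Suc k))"
      using diff[OF x] by blast
    show "\<forall>k. excess n x (Suc k) = 0"
    proof
      fix k
      have "(\<Sum>k<max K0 (Suc k). level_weight TYPE('d) k * excess n x (Suc k)) = 0"
        using K0[of "max K0 (Suc k)"] zero by simp
      then have "level_weight TYPE('d) k * excess n x (Suc k) = 0"
        by (subst (asm) sum_nonneg_eq_0_iff) (auto intro: term_nonneg)
      then show "excess n x (Suc k) = 0"
        using level_weight_pos[OF d, of k] by simp
    qed
  next
    assume "\<forall>k. excess n x (Suc k) = 0"
    then show "energy n x - energy n y = 0" using diff[OF x] by auto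
  qed
  finally show ?thesis .
qed

lemma balanced_family_bounds:
  fixes f :: "'a \<Rightarrow> nat"
  assumes "finite A" "a \<in> A" and balanced: "\<And>b c. b \<in> A \<Longrightarrow> c \<in> A \<Longrightarrow> \<bar>int (f b) - int (f c)\<bar> \<le> 1"
  shows "card A * f a < sum f A + card A" "sum f A < card A * Suc (f a)"
proof -
  have close: "f a \<le> Suc (f b)" "f b \<le> Suc (f a)" if "b \<in> A" for b
    using balanced[OF that assms(2)] by linarith+
  have "(\<Sum>b\<in>A. f a) < (\<Sum>b\<in>A. Suc (f b))"
    using close assms(1,2) by (intro sum_strict_mono_ex1 ballI bexI[of _ a]) auto
  then show "card A * f a < sum f A + card A"
    by (simp add: sum_Suc)
  have "(\<Sum>b\<in>A. f b) < (\<Sum>b\<in>A. Suc (f a))"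
    using close assms(1,2) by (intro sum_strict_mono_ex1 ballI bexI[of _ a]) auto
  then show "sum f A < card A * Suc (f a)"
    by simp
qed

text \<open>
  With \<open>b = 2 ^ d\<close>, a child with \<open>M\<close> points of a cube with \<open>N\<close> points satisfies
  \<open>b (M - 1) < N < b (M + 1)\<close> when its siblings are balanced. Since \<open>t \<le> N \<le> t + 1\<close>, this puts \<open>M\<close>
  between \<open>t div b\<close> and \<open>t div b + 1\<close>.
\<close>

lemma siblings_balanced_imp_level_balanced:
  fixes x :: "nat \<Rightarrow> real ^ 'd::finite"
  assumes x: "configuration n x"
    and siblings: "\<And>k a b c. a \<in> addresses k \<Longrightarrow> b \<in> child_addresses a \<Longrightarrow> c \<in> child_addresses a \<Longrightarrow>
      \<bar>int (occupancy n x (Suc k) b) - int (occupancy n x (Suc k) c)\<bar> \<le> 1"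
    and a: "a \<in> addresses k"
  shows "occupancy n x k a \<in> {n div (2 ^ CARD('d)) ^ k, Suc (n div (2 ^ CARD('d)) ^ k)}"
  using a
proof (induction k arbitrary: a)
  case 0
  have "(addresses 0 :: ('d \<Rightarrow> int) set) = {a}"
    using 0 card_addresses[of 0, where 'd = 'd] by (auto simp: card_1_singleton_iff)
  then have "occupancy n x 0 a = n" using sum_occupancy[OF x, of 0] by simp
  then show ?case by simp
next
  case (Suc k)
  let ?b = "2 ^ CARD('d) :: nat"
  let ?t = "n div ?b ^ k"
  let ?p = "\<lambda>l. a l div 2"
  let ?N = "occupancy n x k ?p" and ?M = "occupancy n x (Suc k) a"
  have child: "a \<in> child_addresses ?p"
    by (simp add: child_addresses_def)
  then have p: "?p \<in> addresses k"
    using Suc.prems by (simp add: child_in_addresses_iff)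
  have "finite (child_addresses ?p)"
    by (rule card_ge_0_finite) (simp add: card_child_addresses)
  then have "?b * ?M < ?N + ?b" "?N < ?b * Suc ?M"
    using balanced_family_bounds[where f = "occupancy n x (Suc k)", OF _ child siblings[OF p]]
    by (simp_all only: sum_occupancy_children card_child_addresses)
  moreover have "?t \<le> ?N" "?N \<le> Suc ?t"
    using Suc.IH[OF p] by auto
  ultimately have "?b * ?M \<le> ?t + ?b" "?t < Suc ?M * ?b"
    by (simp_all only: mult.commute)
  then have "?M \<le> (?t + ?b) div ?b" "?t div ?b < Suc ?M"
    using div_le_mono[of "?b * ?M" "?t + ?b" ?b] less_mult_imp_div_less by simp_all
  moreover have "n div ?b ^ Suc k = ?t div ?b"
    by (simp only: power_Suc2 div_mult2_eq)
  ultimately show ?case by auto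
qed

lemma excess_0_iff_siblings_balanced:
  fixes x :: "nat \<Rightarrow> real ^ 'd::finite"
  assumes x: "configuration n x"
  shows "(\<forall>k. excess n x (Suc k) = 0) \<longleftrightarrow>
    (\<forall>k. \<forall>a \<in> addresses k. \<forall>b \<in> child_addresses a. \<forall>c \<in> child_addresses a.
      \<bar>int (occupancy n x (Suc k) b) - int (occupancy n x (Suc k) c)\<bar> \<le> 1)"
proof
  assume zero: "\<forall>k. excess n x (Suc k) = 0"
  show "\<forall>k. \<forall>a \<in> addresses k. \<forall>b \<in> child_addresses a. \<forall>c \<in> child_addresses a.
      \<bar>int (occupancy n x (Suc k) b) - int (occupancy n x (Suc k) c)\<bar> \<le> 1"
  proof (intro allI ballI)
    fix k and a b c :: "'d \<Rightarrow> int"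
    let ?t = "n div (2 ^ CARD('d)) ^ Suc k"
    assume "a \<in> addresses k" "b \<in> child_addresses a" "c \<in> child_addresses a"
    then have "b \<in> addresses (Suc k)" "c \<in> addresses (Suc k)"
      by (simp_all add: child_in_addresses_iff)
    then have "occupancy n x (Suc k) b \<in> {?t, Suc ?t}" "occupancy n x (Suc k) c \<in> {?t, Suc ?t}"
      using zero excess_eq_0_iff by blast+
    then show "\<bar>int (occupancy n x (Suc k) b) - int (occupancy n x (Suc k) c)\<bar> \<le> 1"
      by (elim insertE emptyE) simp_all
  qed
next
  assume "\<forall>k. \<forall>a \<in> addresses k. \<forall>b \<in> child_addresses a. \<forall>c \<in> child_addresses a.
      \<bar>int (occupancy n x (Suc k) b) - int (occupancy n x (Suc k) c)\<bar> \<le> 1"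
  then have siblings: "\<And>k a b c. a \<in> addresses k \<Longrightarrow> b \<in> child_addresses a \<Longrightarrow> c \<in> child_addresses a \<Longrightarrow>
      \<bar>int (occupancy n x (Suc k) b) - int (occupancy n x (Suc k) c)\<bar> \<le> 1" by blast
  have "occupancy n x k a \<in> {n div (2 ^ CARD('d)) ^ k, Suc (n div (2 ^ CARD('d)) ^ k)}"
    if "a \<in> addresses k" for k a
    using x siblings that by (rule siblings_balanced_imp_level_balanced)
  then show "\<forall>k. excess n x (Suc k) = 0"
    unfolding excess_eq_0_iff by blast
qed

theorem theorem4:
  fixes \<sigma> :: "nat \<Rightarrow> real ^ 'd"
  assumes "CARD('d) \<ge> 3" and "n \<ge> 2" and "configuration n \<sigma>"
  shows "ground_state n \<sigma> \<longleftrightarrow>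
    (\<forall>k. \<forall>D \<in> dyadic_cubes k.
       num_points n \<sigma> D = (\<Sum>D' \<in> children k D. num_points n \<sigma> D') \<and>
       (\<forall>D\<^sub>1 \<in> children k D. \<forall>D\<^sub>2 \<in> children k D.
          \<bar>int (num_points n \<sigma> D\<^sub>1) - int (num_points n \<sigma> D\<^sub>2)\<bar> \<le> 1))"
proof -
  have "(\<Sum>D' \<in> children k (cell k a). num_points n \<sigma> D') = num_points n \<sigma> (cell k a)"
    if "a \<in> addresses k" for k a
    unfolding children_cell[OF that]
    by (subst sum.reindex[OF inj_on_subset[OF inj_cell subset_UNIV]])
       (simp add: num_points_cell sum_occupancy_children)
  then show ?thesis
    unfolding ground_state_iff_excess_0[OF assms(1,3)] excess_0_iff_siblings_balanced[OF assms(3)]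
      dyadic_cubes_eq
    by (simp add: children_cell num_points_cell)
qed

end
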